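(* Let $A\in\mathcal W(E)$ with representation $A=\sum_{j\in G}M_{b^{(j)}}V_j$, where $(b^{(j)})_{j\in G}\subset\ell^\infty(G,L(Y))$ and $\|A\|_{\mathcal W}=\sum_{j\in G}\|b^{(j)}\|_\infty<\infty$. Let $W\subset G$ be a finite set and let $w\in\ell^2(G)$ with $w\neq0$ and $\operatorname{supp}w\subset W$. For $k\in G$ let $A_k:=P_kAP_k$ (acting on $\ell^2(k+W,Y)$), and for $x\in E$ let $\tilde x_k:=M_{V_kw}x$, i.e. $(\tilde x_k)_i=w_{i-k}x_i$ for $i\in G$. Then for every nonzero $x\in E$ there exists a $k\in G$ such that $\tilde x_k\neq0$ and $$\frac{\|A_k\tilde x_k\|}{\|\tilde x_k\|}\ \le\ \frac{\|Ax\|}{\|x\|}+\varepsilon(w,A),\qquad\text{where}\qquad\varepsilon(w,A):=\sum_{j\in G}\|b^{(j)}\|_\infty\,\frac{\|P_0V_jw-w\|_2}{\|w\|_2}.$$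
   Context: $(G,+)$ is a countable Abelian group with neutral element $0$ and counting measure, $Y$ is a complex Hilbert space, $E:=\ell^2(G,Y)$, $\ell^2(G):=\ell^2(G,\mathbb C)$. For $b\in\ell^\infty(G,L(Y))$ (or a bounded scalar function $b$ on $G$), $M_b$ is the multiplication operator $(M_bx)_i=b_ix_i$. For $j\in G$, $V_j$ is the shift $(V_jx)_i=x_{i-j}$ (on $E$ and on $\ell^2(G)$). The Wiener algebra $\mathcal W(E)$ is the set of all operators $A=\sum_{j\in G}M_{b^{(j)}}V_j$ with $\|A\|_{\mathcal W}:=\sum_{j\in G}\|b^{(j)}\|_\infty<\infty$. For $k\in G$, $P_k$ is the operator (on $E$ or on $\ell^2(G)$) of multiplication by the characteristic function of $k+W$; its range in $E$ is identified with $\ell^2(k+W,Y)$. $\operatorname{supp}x=\{i:x_i\ne0\}$. *)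

theory Defs
  imports "HOL-Analysis.Analysis"
begin

section \<open>Complex Hilbert spaces\<close>

text \<open>
  The distribution only has real inner product spaces. The norm, metric and topology below are
  the ones of \<^class>\<open>real_normed_vector\<close>, so that bounded operators, their norm and infinite sums
  are those of the library. The inner product is linear in its first argument; its positive
  definiteness is contained in \<open>cinner_norm\<close>.
\<close>

class complex_inner_space = real_normed_vector +
  fixes scaleC :: "complex \<Rightarrow> 'a \<Rightarrow> 'a"  (infixr "*\<^sub>C" 75)
    and cinner :: "'a \<Rightarrow> 'a \<Rightarrow> complex"
  assumes scaleC_add_right: "c *\<^sub>C (x + y) = c *\<^sub>C x + c *\<^sub>C y"
    and scaleC_add_left: "(c + d) *\<^sub>C x = c *\<^sub>C x + d *\<^sub>C x"
    and scaleC_scaleC: "c *\<^sub>C d *\<^sub>C x = (c * d) *\<^sub>C x"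
    and scaleR_scaleC: "r *\<^sub>R x = complex_of_real r *\<^sub>C x"
    and cinner_commute: "cinner x y = cnj (cinner y x)"
    and cinner_add_left: "cinner (x + y) z = cinner x z + cinner y z"
    and cinner_scaleC_left: "cinner (c *\<^sub>C x) y = c * cinner x y"
    and cinner_norm: "cinner x x = complex_of_real ((norm x)\<^sup>2)"

class complex_hilbert_space = complex_inner_space + complete_space

lemma scaleC_one: "1 *\<^sub>C x = (x :: 'a::complex_inner_space)"
  using scaleR_scaleC[of 1 x] by simp

lemma norm_scaleC: "norm (c *\<^sub>C x) = cmod c * norm (x :: 'a::complex_inner_space)"
proof -
  have "complex_of_real ((norm (c *\<^sub>C x))\<^sup>2) = c * cinner x (c *\<^sub>C x)"
    by (simp only: cinner_norm[symmetric] cinner_scaleC_left)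
  also have "\<dots> = c * cnj c * cnj (cinner x x)"
    by (simp add: cinner_commute[of x "c *\<^sub>C x"] cinner_scaleC_left)
  also have "\<dots> = complex_of_real ((cmod c * norm x)\<^sup>2)"
    by (simp add: cinner_norm complex_norm_square[symmetric] power_mult_distrib)
  finally have "(norm (c *\<^sub>C x))\<^sup>2 = (cmod c * norm x)\<^sup>2"
    using of_real_eq_iff by blast
  then show ?thesis
    by (simp add: power2_eq_iff_nonneg)
qed

instantiation complex :: complex_hilbert_space
begin

definition scaleC_complex :: "complex \<Rightarrow> complex \<Rightarrow> complex" where
  "scaleC_complex c x = c * x"

definition cinner_complex :: "complex \<Rightarrow> complex \<Rightarrow> complex" where
  "cinner_complex x y = x * cnj y"

instance
  by standard
    (simp_all add: scaleC_complex_def cinner_complex_def algebra_simps scaleR_conv_of_real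
      complex_norm_square[symmetric])

end


section \<open>The space of square-summable functions\<close>

definition is_ell2 :: "('g \<Rightarrow> 'y::real_normed_vector) \<Rightarrow> bool" where
  "is_ell2 f \<longleftrightarrow> (\<lambda>i. (norm (f i))\<^sup>2) summable_on UNIV"

definition ell2_norm :: "('g \<Rightarrow> 'y::real_normed_vector) \<Rightarrow> real" where
  "ell2_norm f = sqrt (\<Sum>\<^sub>\<infinity>i. (norm (f i))\<^sup>2)"

lemma ell2_norm_nonneg: "0 \<le> ell2_norm f"
  by (simp add: ell2_norm_def infsum_nonneg)

lemma L2_set_le_ell2_norm:
  assumes "is_ell2 f" "finite F"
  shows "L2_set (\<lambda>i. norm (f i)) F \<le> ell2_norm f"
  using assms unfolding L2_set_def ell2_norm_def is_ell2_def
  by (auto intro!: finite_sum_le_infsum)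

lemma ell2_boundedI:
  assumes "\<And>F. finite F \<Longrightarrow> L2_set (\<lambda>i. norm (f i)) F \<le> C"
  shows "is_ell2 f" "ell2_norm f \<le> C"
proof -
  have C: "0 \<le> C"
    using assms[of "{}"] by simp
  have le: "(\<Sum>i\<in>F. (norm (f i))\<^sup>2) \<le> C\<^sup>2" if "finite F" for F
    using assms[OF that] C unfolding L2_set_def by (simp add: real_sqrt_le_iff sqrt_le_D)
  show *: "is_ell2 f"
    unfolding is_ell2_def
    by (rule nonneg_bdd_above_summable_on) (use le in \<open>auto intro!: bdd_aboveI[of _ "C\<^sup>2"]\<close>)
  have "(\<Sum>\<^sub>\<infinity>i. (norm (f i))\<^sup>2) \<le> C\<^sup>2"
    using * le unfolding is_ell2_def by (intro infsum_le_finite_sums) auto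
  then show "ell2_norm f \<le> C"
    unfolding ell2_norm_def using C by (simp add: real_le_lsqrt)
qed

lemma ell2_zero: "is_ell2 (\<lambda>_. 0)"
  by (simp add: is_ell2_def)

lemma ell2_mono:
  assumes "is_ell2 f" "\<And>i. norm (g i) \<le> c * norm (f i)" "0 \<le> c"
  shows "is_ell2 g" "ell2_norm g \<le> c * ell2_norm f"
proof -
  have *: "L2_set (\<lambda>i. norm (g i)) F \<le> c * ell2_norm f" if "finite F" for F
  proof -
    have "L2_set (\<lambda>i. norm (g i)) F \<le> L2_set (\<lambda>i. c * norm (f i)) F"
      by (rule L2_set_mono) (use assms in auto)
    also have "\<dots> = c * L2_set (\<lambda>i. norm (f i)) F"
      using assms(3) by (simp add: L2_set_right_distrib)
    also have "\<dots> \<le> c * ell2_norm f"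
      using L2_set_le_ell2_norm[OF assms(1) that] assms(3) by (simp add: mult_left_mono)
    finally show ?thesis .
  qed
  show "is_ell2 g" "ell2_norm g \<le> c * ell2_norm f"
    using ell2_boundedI[OF *] by auto
qed

lemma ell2_add:
  assumes "is_ell2 f" "is_ell2 g"
  shows "is_ell2 (\<lambda>i. f i + g i)" "ell2_norm (\<lambda>i. f i + g i) \<le> ell2_norm f + ell2_norm g"
proof -
  have *: "L2_set (\<lambda>i. norm (f i + g i)) F \<le> ell2_norm f + ell2_norm g" if "finite F" for F
  proof -
    have "L2_set (\<lambda>i. norm (f i + g i)) F \<le> L2_set (\<lambda>i. norm (f i) + norm (g i)) F"
      by (rule L2_set_mono) (auto intro: norm_triangle_ineq)
    also have "\<dots> \<le> L2_set (\<lambda>i. norm (f i)) F + L2_set (\<lambda>i. norm (g i)) F"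
      by (rule L2_set_triangle_ineq)
    also have "\<dots> \<le> ell2_norm f + ell2_norm g"
      using L2_set_le_ell2_norm[OF assms(1) that] L2_set_le_ell2_norm[OF assms(2) that] by simp
    finally show ?thesis .
  qed
  show "is_ell2 (\<lambda>i. f i + g i)" "ell2_norm (\<lambda>i. f i + g i) \<le> ell2_norm f + ell2_norm g"
    using ell2_boundedI[OF *] by auto
qed

lemma ell2_scaleR: "is_ell2 f \<Longrightarrow> is_ell2 (\<lambda>i. r *\<^sub>R f i)"
  by (rule ell2_mono(1)[where c = "\<bar>r\<bar>"]) auto

lemma ell2_uminus: "is_ell2 f \<Longrightarrow> is_ell2 (\<lambda>i. - f i)"
  by (rule ell2_mono(1)[where c = 1]) auto

lemma ell2_diff: "is_ell2 f \<Longrightarrow> is_ell2 g \<Longrightarrow> is_ell2 (\<lambda>i. f i - g i)"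
  using ell2_add(1)[OF _ ell2_uminus] by force

typedef (overloaded) ('g, 'y::real_normed_vector) ell2 = "{f :: 'g \<Rightarrow> 'y. is_ell2 f}"
  morphisms ell2_apply Abs_ell2
  using ell2_zero by auto

setup_lifting type_definition_ell2

instantiation ell2 :: (type, real_normed_vector) real_normed_vector
begin

lift_definition zero_ell2 :: "('a, 'b) ell2" is "\<lambda>_. 0"
  by (rule ell2_zero)

lift_definition plus_ell2 :: "('a, 'b) ell2 \<Rightarrow> ('a, 'b) ell2 \<Rightarrow> ('a, 'b) ell2"
  is "\<lambda>f g i. f i + g i"
  by (rule ell2_add)

lift_definition uminus_ell2 :: "('a, 'b) ell2 \<Rightarrow> ('a, 'b) ell2"
  is "\<lambda>f i. - f i"
  by (rule ell2_uminus)

lift_definition minus_ell2 :: "('a, 'b) ell2 \<Rightarrow> ('a, 'b) ell2 \<Rightarrow> ('a, 'b) ell2"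
  is "\<lambda>f g i. f i - g i"
  by (rule ell2_diff)

lift_definition scaleR_ell2 :: "real \<Rightarrow> ('a, 'b) ell2 \<Rightarrow> ('a, 'b) ell2"
  is "\<lambda>r f i. r *\<^sub>R f i"
  by (rule ell2_scaleR)

lift_definition norm_ell2 :: "('a, 'b) ell2 \<Rightarrow> real" is ell2_norm .

definition sgn_ell2 :: "('a, 'b) ell2 \<Rightarrow> ('a, 'b) ell2" where
  "sgn_ell2 x = inverse (norm x) *\<^sub>R x"

definition dist_ell2 :: "('a, 'b) ell2 \<Rightarrow> ('a, 'b) ell2 \<Rightarrow> real" where
  "dist_ell2 x y = norm (x - y)"

definition uniformity_ell2 :: "(('a, 'b) ell2 \<times> ('a, 'b) ell2) filter" where
  "uniformity_ell2 = (INF e\<in>{0<..}. principal {(x, y). dist x y < e})"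

definition open_ell2 :: "('a, 'b) ell2 set \<Rightarrow> bool" where
  "open_ell2 U \<longleftrightarrow> (\<forall>x\<in>U. \<forall>\<^sub>F (x', y) in uniformity. x' = x \<longrightarrow> y \<in> U)"

instance
proof
  fix x y z :: "('a, 'b) ell2" and r s :: real and U :: "('a, 'b) ell2 set"
  show "x + y + z = x + (y + z)" by transfer (simp add: add.assoc)
  show "x + y = y + x" by transfer (simp add: add.commute)
  show "0 + x = x" by transfer simp
  show "- x + x = 0" by transfer simp
  show "x - y = x + - y" by transfer simp
  show "r *\<^sub>R (x + y) = r *\<^sub>R x + r *\<^sub>R y" by transfer (simp add: scaleR_add_right)
  show "(r + s) *\<^sub>R x = r *\<^sub>R x + s *\<^sub>R x" by transfer (simp add: scaleR_add_left)
  show "r *\<^sub>R s *\<^sub>R x = (r * s) *\<^sub>R x" by transfer simp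
  show "1 *\<^sub>R x = x" by transfer simp
  show "norm (x + y) \<le> norm x + norm y" by transfer (rule ell2_add)
  show "norm (r *\<^sub>R x) = \<bar>r\<bar> * norm x"
    by transfer
      (simp add: ell2_norm_def power_mult_distrib infsum_cmult_right' real_sqrt_mult)
  show "(norm x = 0) = (x = 0)"
  proof
    show "norm x = 0 \<Longrightarrow> x = 0"
    proof transfer
      fix f :: "'a \<Rightarrow> 'b"
      assume f: "is_ell2 f" "ell2_norm f = 0"
      have "f i = 0" for i
        using L2_set_le_ell2_norm[OF f(1), of "{i}"] f(2) by (simp add: L2_set_def)
      then show "f = (\<lambda>_. 0)" by auto
    qed
    show "x = 0 \<Longrightarrow> norm x = 0"
      by transfer (simp add: ell2_norm_def)
  qed
qed (simp_all only: sgn_ell2_def dist_ell2_def uniformity_ell2_def open_ell2_def)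

end

definition ell2_supp :: "('g, 'y::real_normed_vector) ell2 \<Rightarrow> 'g set" where
  "ell2_supp x = {i. ell2_apply x i \<noteq> 0}"


section \<open>Shifts and multiplication operators\<close>

lemma ell2_shift:
  fixes f :: "'g::ab_group_add \<Rightarrow> 'y::real_normed_vector"
  assumes "is_ell2 f"
  shows "is_ell2 (\<lambda>i. f (i - j))" "ell2_norm (\<lambda>i. f (i - j)) = ell2_norm f"
proof -
  have bij: "bij_betw (\<lambda>i. i - j) UNIV (UNIV :: 'g set)"
    by (rule bij_betw_byWitness[where f' = "\<lambda>i. i + j"]) auto
  show "is_ell2 (\<lambda>i. f (i - j))"
    using assms summable_on_reindex_bij_betw[OF bij, of "\<lambda>i. (norm (f i))\<^sup>2"]
    unfolding is_ell2_def by simp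
  show "ell2_norm (\<lambda>i. f (i - j)) = ell2_norm f"
    using infsum_reindex_bij_betw[OF bij, of "\<lambda>i. (norm (f i))\<^sup>2"]
    unfolding ell2_norm_def by simp
qed

lift_definition shift_fun ::
    "'g::ab_group_add \<Rightarrow> ('g, 'y::real_normed_vector) ell2 \<Rightarrow> ('g, 'y) ell2"
  is "\<lambda>j f i. f (i - j)"
  by (rule ell2_shift)

lift_definition shift_op ::
    "'g::ab_group_add \<Rightarrow> ('g, 'y::real_normed_vector) ell2 \<Rightarrow>\<^sub>L ('g, 'y) ell2"
  is shift_fun
proof (rule bounded_linear_intro[where K = 1])
  fix j :: 'g and x y :: "('g, 'y) ell2" and r :: real
  show "shift_fun j (x + y) = shift_fun j x + shift_fun j y" by transfer simp
  show "shift_fun j (r *\<^sub>R x) = r *\<^sub>R shift_fun j x" by transfer simp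
  show "norm (shift_fun j x) \<le> norm x * 1" by transfer (simp add: ell2_shift)
qed

lemma shift_op_apply: "ell2_apply (blinfun_apply (shift_op j) x) i = ell2_apply x (i - j)"
  by (simp add: shift_op.rep_eq shift_fun.rep_eq)

lemma mult_ell2:
  fixes b :: "'g \<Rightarrow> 'y::real_normed_vector \<Rightarrow>\<^sub>L 'y"
  assumes "is_ell2 f" "\<And>i. norm (b i) \<le> c"
  shows "is_ell2 (\<lambda>i. blinfun_apply (b i) (f i))"
    "ell2_norm (\<lambda>i. blinfun_apply (b i) (f i)) \<le> c * ell2_norm f"
proof -
  have "norm (blinfun_apply (b i) (f i)) \<le> c * norm (f i)" for i
    using norm_blinfun[of "b i" "f i"] mult_right_mono[OF assms(2)[of i], of "norm (f i)"] by simp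
  moreover have "0 \<le> c"
    using assms(2) norm_ge_zero order_trans by blast
  ultimately show "is_ell2 (\<lambda>i. blinfun_apply (b i) (f i))"
      "ell2_norm (\<lambda>i. blinfun_apply (b i) (f i)) \<le> c * ell2_norm f"
    by (auto intro: ell2_mono[OF assms(1)])
qed

text \<open>
  \<open>mult_op b\<close> is the multiplication operator with symbol \<open>b\<close>. It is only meaningful for bounded
  \<open>b\<close>; for unbounded \<open>b\<close> it is set to zero, to have a total function.
\<close>

lift_definition mult_fun ::
    "('g \<Rightarrow> 'y::real_normed_vector \<Rightarrow>\<^sub>L 'y) \<Rightarrow> ('g, 'y) ell2 \<Rightarrow> ('g, 'y) ell2"
  is "\<lambda>b f i. if bounded (range b) then blinfun_apply (b i) (f i) else 0"
proof -
  fix b :: "'g \<Rightarrow> 'y \<Rightarrow>\<^sub>L 'y" and f :: "'g \<Rightarrow> 'y"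
  assume "is_ell2 f"
  then show "is_ell2 (\<lambda>i. if bounded (range b) then blinfun_apply (b i) (f i) else 0)"
  proof (cases "bounded (range b)")
    case True
    then obtain c where c: "\<And>i. norm (b i) \<le> c"
      by (auto simp: bounded_iff)
    show ?thesis
      using mult_ell2(1)[OF \<open>is_ell2 f\<close> c] True by simp
  qed (simp add: ell2_zero)
qed

lemma mult_fun_bound:
  assumes "\<And>i. norm (b i) \<le> c"
  shows "norm (mult_fun b x) \<le> c * norm x"
proof -
  have "bounded (range b)"
    using assms by (auto simp: bounded_iff)
  then show ?thesis
    using assms mult_ell2(2)[of "ell2_apply x" b c] ell2_apply[of x]
    by (simp add: norm_ell2.rep_eq mult_fun.rep_eq)
qed

lemma mult_fun_unbounded: "\<not> bounded (range b) \<Longrightarrow> mult_fun b x = 0"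
  by (simp add: ell2_apply_inject[symmetric] mult_fun.rep_eq zero_ell2.rep_eq)

lift_definition mult_op ::
    "('g \<Rightarrow> 'y::real_normed_vector \<Rightarrow>\<^sub>L 'y) \<Rightarrow> ('g, 'y) ell2 \<Rightarrow>\<^sub>L ('g, 'y) ell2"
  is mult_fun
proof -
  fix b :: "'g \<Rightarrow> 'y \<Rightarrow>\<^sub>L 'y"
  obtain c where c: "norm (mult_fun b x) \<le> c * norm x" for x
  proof (cases "bounded (range b)")
    case True
    then obtain c where "\<And>i. norm (b i) \<le> c"
      by (auto simp: bounded_iff)
    then show ?thesis
      using that[of c] mult_fun_bound by blast
  next
    case False
    then show ?thesis
      using that[of 0] by (simp add: mult_fun_unbounded)
  qed
  show "bounded_linear (mult_fun b)"
  proof (rule bounded_linear_intro[where K = c])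
    fix x y :: "('g, 'y) ell2" and r :: real
    show "mult_fun b (x + y) = mult_fun b x + mult_fun b y"
      by (auto simp: ell2_apply_inject[symmetric] mult_fun.rep_eq plus_ell2.rep_eq
          blinfun.add_right)
    show "mult_fun b (r *\<^sub>R x) = r *\<^sub>R mult_fun b x"
      by (auto simp: ell2_apply_inject[symmetric] mult_fun.rep_eq scaleR_ell2.rep_eq
          blinfun.scaleR_right)
    show "norm (mult_fun b x) \<le> norm x * c"
      using c[of x] by (simp add: mult.commute)
  qed
qed

lemma mult_op_apply:
  "bounded (range b) \<Longrightarrow>
    ell2_apply (blinfun_apply (mult_op b) x) i = blinfun_apply (b i) (ell2_apply x i)"
  by (simp add: mult_op.rep_eq mult_fun.rep_eq)

lift_definition scaleC_blinfun :: "complex \<Rightarrow> 'y::complex_inner_space \<Rightarrow>\<^sub>L 'y"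
  is "\<lambda>c y. c *\<^sub>C y"
proof -
  fix c :: complex
  show "bounded_linear (\<lambda>y::'y. c *\<^sub>C y)"
    by (rule bounded_linear_intro[where K = "cmod c"])
      (simp_all add: scaleC_add_right scaleR_scaleC scaleC_scaleC mult.commute norm_scaleC)
qed

lemma norm_scaleC_blinfun_le: "norm (scaleC_blinfun c) \<le> cmod c"
  by (rule norm_blinfun_bound) (simp_all add: scaleC_blinfun.rep_eq norm_scaleC)

text \<open>The multiplication operator of a bounded scalar function.\<close>

definition scalar_mult_op ::
    "('g \<Rightarrow> complex) \<Rightarrow> ('g, 'y::complex_inner_space) ell2 \<Rightarrow>\<^sub>L ('g, 'y) ell2" where
  "scalar_mult_op c = mult_op (\<lambda>i. scaleC_blinfun (c i))"

lemma scalar_mult_op_apply: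
  assumes "bounded (range c)"
  shows "ell2_apply (blinfun_apply (scalar_mult_op c) x) i = c i *\<^sub>C ell2_apply x i"
proof -
  obtain C where "\<And>i. cmod (c i) \<le> C"
    using assms by (auto simp: bounded_iff)
  then have "bounded (range (\<lambda>i. scaleC_blinfun (c i) :: 'b \<Rightarrow>\<^sub>L 'b))"
    by (auto simp: bounded_iff intro!: exI[of _ C] order_trans[OF norm_scaleC_blinfun_le])
  then show ?thesis
    by (simp add: scalar_mult_op_def mult_op_apply scaleC_blinfun.rep_eq)
qed

definition proj_op ::
    "'g::ab_group_add set \<Rightarrow> 'g \<Rightarrow> ('g, 'y::complex_inner_space) ell2 \<Rightarrow>\<^sub>L ('g, 'y) ell2" where
  "proj_op W k = scalar_mult_op (indicator ((+) k ` W))"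

text \<open>
  \<open>section_op W A k\<close> is \<open>A\<^sub>k = P\<^sub>k A P\<^sub>k\<close>. The space of square-summable functions on \<open>k + W\<close> is
  identified with the range of \<open>P\<^sub>k\<close>, on which the norm is the one of the whole space.
\<close>

definition section_op ::
    "'g::ab_group_add set \<Rightarrow> (('g, 'y::complex_inner_space) ell2 \<Rightarrow>\<^sub>L ('g, 'y) ell2) \<Rightarrow> 'g \<Rightarrow>
      (('g, 'y) ell2 \<Rightarrow>\<^sub>L ('g, 'y) ell2)" where
  "section_op W A k = proj_op W k o\<^sub>L A o\<^sub>L proj_op W k"


section \<open>The Wiener algebra\<close>

definition clinear_blinfun ::
    "('a::complex_inner_space \<Rightarrow>\<^sub>L 'b::complex_inner_space) \<Rightarrow> bool" where
  "clinear_blinfun T \<longleftrightarrow>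
    (\<forall>c y. blinfun_apply T (c *\<^sub>C y) = c *\<^sub>C blinfun_apply T y)"

text \<open>Bounded functions with values in the bounded complex-linear operators.\<close>

definition ell_infty :: "('g \<Rightarrow> 'y::complex_inner_space \<Rightarrow>\<^sub>L 'y) set" where
  "ell_infty = {b. bounded (range b) \<and> (\<forall>i. clinear_blinfun (b i))}"

definition sup_norm :: "('g \<Rightarrow> 'a::real_normed_vector) \<Rightarrow> real" where
  "sup_norm b = (SUP i. norm (b i))"

text \<open>
  \<open>A\<close> belongs to the Wiener algebra and \<open>A = (\<Sum>j. M\<^bsub>b j\<^esub> V\<^sub>j)\<close> is its representation, where
  \<open>V\<^sub>j\<close> is \<open>shift_op j\<close>. The series converges in operator norm (even absolutely). In particular \<open>A\<close> is
  complex-linear, being a limit of complex-linear operators.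
\<close>

definition wiener_representation ::
    "(('g::ab_group_add, 'y::complex_inner_space) ell2 \<Rightarrow>\<^sub>L ('g, 'y) ell2) \<Rightarrow>
      ('g \<Rightarrow> 'g \<Rightarrow> 'y \<Rightarrow>\<^sub>L 'y) \<Rightarrow> bool" where
  "wiener_representation A b \<longleftrightarrow>
    (\<forall>j. b j \<in> ell_infty) \<and>
    (\<lambda>j. sup_norm (b j)) summable_on UNIV \<and>
    ((\<lambda>j. mult_op (b j) o\<^sub>L shift_op j) has_sum A) UNIV"

text \<open>
  \<open>loc_error W w b\<close> is \<open>\<epsilon>(w, A)\<close>, in terms of the coefficients \<open>b\<close> of \<open>A\<close>. The operators \<open>P\<^sub>0\<close> and
  \<open>V\<^sub>j\<close> act on scalar functions here.
\<close>

definition loc_error ::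
    "'g::ab_group_add set \<Rightarrow> ('g, complex) ell2 \<Rightarrow>
      ('g \<Rightarrow> 'g \<Rightarrow> 'y::complex_inner_space \<Rightarrow>\<^sub>L 'y) \<Rightarrow> real" where
  "loc_error W w b =
    (\<Sum>\<^sub>\<infinity>j. sup_norm (b j) *
      (norm (blinfun_apply (proj_op W 0) (blinfun_apply (shift_op j) w) - w) / norm w))"

text \<open>The infinite sum above is a genuine one.\<close>

lemma summable_loc_error:
  fixes W :: "'g::ab_group_add set" and w :: "('g, complex) ell2"
    and A :: "('g, 'y::complex_inner_space) ell2 \<Rightarrow>\<^sub>L ('g, 'y) ell2"
  assumes "wiener_representation A b"
  shows "(\<lambda>j. sup_norm (b j) *
    (norm (blinfun_apply (proj_op W 0) (blinfun_apply (shift_op j) w) - w) / norm w))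
      summable_on UNIV"
proof -
  define K where
    "K = (norm (proj_op W 0 :: ('g, complex) ell2 \<Rightarrow>\<^sub>L _) * norm w + norm w) / norm w"
  have K: "norm (blinfun_apply (proj_op W 0) (blinfun_apply (shift_op j) w) - w) / norm w \<le> K"
    for j
  proof -
    have "norm (blinfun_apply (shift_op j) w) = norm w"
      by (simp add: shift_op.rep_eq norm_ell2.rep_eq shift_fun.rep_eq ell2_shift(2)
          ell2_apply[simplified])
    then have "norm (blinfun_apply (proj_op W 0) (blinfun_apply (shift_op j) w))
        \<le> norm (proj_op W 0 :: ('g, complex) ell2 \<Rightarrow>\<^sub>L _) * norm w"
      using norm_blinfun[of "proj_op W 0" "blinfun_apply (shift_op j) w"] by simp
    then have "norm (blinfun_apply (proj_op W 0) (blinfun_apply (shift_op j) w) - w)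
        \<le> norm (proj_op W 0 :: ('g, complex) ell2 \<Rightarrow>\<^sub>L _) * norm w + norm w"
      by (intro order_trans[OF norm_triangle_ineq4]) simp
    then show ?thesis
      unfolding K_def by (rule divide_right_mono) simp
  qed
  have nonneg: "0 \<le> sup_norm (b j)" for j
  proof -
    have "bdd_above (range (\<lambda>i. norm (b j i)))"
      using assms by (auto simp: wiener_representation_def ell_infty_def bounded_iff bdd_above_def)
    then have "norm (b j 0) \<le> sup_norm (b j)"
      unfolding sup_norm_def by (rule cSUP_upper2) auto
    then show ?thesis
      using norm_ge_zero order_trans by blast
  qed
  have "(\<lambda>j. sup_norm (b j) * K) summable_on UNIV"
    using assms by (intro summable_on_cmult_left) (simp add: wiener_representation_def)
  then show ?thesis
    by (rule summable_on_comparison_test)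
      (intro mult_left_mono K nonneg mult_nonneg_nonneg divide_nonneg_nonneg norm_ge_zero)+
qed

definition localize ::
    "('g::ab_group_add, complex) ell2 \<Rightarrow> ('g, 'y::complex_inner_space) ell2 \<Rightarrow> 'g \<Rightarrow>
      ('g, 'y) ell2" where
  "localize w x k = blinfun_apply (scalar_mult_op (ell2_apply (blinfun_apply (shift_op k) w))) x"

lemma ell2_apply_bounded: "bounded (range (ell2_apply x))"
proof -
  have "norm (ell2_apply x i) \<le> norm x" for i
    using L2_set_le_ell2_norm[of "ell2_apply x" "{i}"] ell2_apply[of x]
    by (simp add: L2_set_def norm_ell2.rep_eq)
  then show ?thesis
    by (auto simp: bounded_iff)
qed

lemma localize_apply:
  "ell2_apply (localize w x k) i = ell2_apply w (i - k) *\<^sub>C ell2_apply x i"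
  by (simp only: localize_def scalar_mult_op_apply[OF ell2_apply_bounded] shift_op_apply)

lemma proj_op_apply:
  fixes x :: "('g::ab_group_add, 'y::complex_inner_space) ell2"
  shows "ell2_apply (blinfun_apply (proj_op W k) x) i =
    (if i \<in> (+) k ` W then ell2_apply x i else 0)"
proof -
  have "bounded (range (indicator ((+) k ` W) :: 'g \<Rightarrow> complex))"
    by (auto simp: bounded_iff indicator_def intro!: exI[of _ 1])
  moreover have "0 *\<^sub>C y = 0" for y :: 'y
    using scaleR_scaleC[of 0 y] by simp
  ultimately show ?thesis
    by (simp add: proj_op_def scalar_mult_op_apply indicator_def scaleC_one)
qed

end

theory Submission
  imports Defs
begin

text \<open>
  The estimate holds on average over \<open>k\<close>, in the sense of square sums, and therefore for some \<open>k\<close>.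
  The family \<open>(\<lambda>k. localize v y k)\<close> has square norm sum \<open>(norm v * norm y)\<^sup>2\<close>
  (\<open>has_sum_localize\<close>), by exchanging the sums over \<open>k\<close> and over the points of the group. For \<open>v = w\<close>
  this evaluates both the family of the localized vectors \<open>x\<^sub>k\<close> and that of the localizations of
  \<open>A x\<close> exactly.

  It remains to compare \<open>A\<^sub>k x\<^sub>k\<close> with the localization of \<open>A x\<close> at \<open>k\<close>. A multiplication operator
  commutes with the scalar factor \<open>V\<^sub>k w\<close>, while the shift \<open>V\<^sub>j\<close> moves it; hence for a single
  summand \<open>M\<^bsub>b\<^esub> V\<^sub>j\<close> of \<open>A\<close> the difference is again a localization, of the vector \<open>M\<^bsub>b\<^esub> V\<^sub>j x\<close> by the
  window \<open>P\<^sub>0 V\<^sub>j w - w\<close> (\<open>section_op_localize_diff\<close>). The norm of this family over all \<open>k\<close> is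
  therefore the product of the norms of the window and of \<open>M\<^bsub>b\<^esub> V\<^sub>j x\<close>, the latter being at most
  \<open>sup_norm b * norm x\<close>, and Minkowski's inequality for infinite sums (\<open>ell2_has_sum_le\<close>) adds the summands up
  to \<open>loc_error W w b * norm w * norm x\<close>. The triangle inequality in the space of square-summable
  families then gives
  \<open>ell2_norm (\<lambda>k. A\<^sub>k x\<^sub>k) \<le> (norm (A x) / norm x + loc_error W w b) * ell2_norm (\<lambda>k. x\<^sub>k)\<close>,
  and such an inequality between two families forces the same inequality at some index
  (\<open>ex_norm_le_if_ell2_norm_le\<close>).
\<close>

section \<open>Square-summable families\<close>

lemma has_sum_ell2_norm:
  assumes "is_ell2 f"
  shows "((\<lambda>i. (norm (f i))\<^sup>2) has_sum (ell2_norm f)\<^sup>2) UNIV"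
  using assms has_sum_infsum unfolding is_ell2_def ell2_norm_def
  by (simp add: infsum_nonneg)

text \<open>
  Minkowski's inequality for infinitely many summands. The sum \<open>s\<close> is only taken pointwise: on a finite
  set of indices \<open>k\<close>, the bound for finite partial sums passes to the limit, and a uniform bound on all
  finite index sets is what characterizes the norm. Hence no completeness is involved.
\<close>

lemma ell2_has_sum_le:
  fixes D :: "'j \<Rightarrow> 'k \<Rightarrow> 'a::real_normed_vector"
  assumes s: "\<And>k. ((\<lambda>j. D j k) has_sum s k) UNIV"
    and D: "\<And>j. is_ell2 (D j)" "\<And>j. ell2_norm (D j) \<le> c j"
    and c: "c summable_on UNIV"
  shows "is_ell2 s" "ell2_norm s \<le> (\<Sum>\<^sub>\<infinity>j. c j)"
proof -
  have c_nonneg: "0 \<le> c j" for j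
    using D(2)[of j] ell2_norm_nonneg[of "D j"] by linarith
  have "L2_set (\<lambda>k. norm (s k)) F \<le> (\<Sum>\<^sub>\<infinity>j. c j)" if F: "finite F" for F
  proof (rule tendsto_upperbound)
    show "((\<lambda>J. L2_set (\<lambda>k. norm (\<Sum>j\<in>J. D j k)) F) \<longlongrightarrow> L2_set (\<lambda>k. norm (s k)) F)
        (finite_subsets_at_top UNIV)"
      unfolding L2_set_def
      by (intro tendsto_intros) (use s in \<open>auto simp: has_sum_def\<close>)
    have "L2_set (\<lambda>k. norm (\<Sum>j\<in>J. D j k)) F \<le> (\<Sum>\<^sub>\<infinity>j. c j)" if J: "finite J" for J
    proof -
      have "L2_set (\<lambda>k. norm (\<Sum>j\<in>J. D j k)) F \<le> (\<Sum>j\<in>J. L2_set (\<lambda>k. norm (D j k)) F)"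
        using J
      proof (induction J rule: finite_induct)
        case (insert a J)
        have "L2_set (\<lambda>k. norm (\<Sum>j\<in>insert a J. D j k)) F
            \<le> L2_set (\<lambda>k. norm (D a k) + norm (\<Sum>j\<in>J. D j k)) F"
          using insert.hyps by (intro L2_set_mono) (auto intro: norm_triangle_ineq)
        also have "\<dots> \<le> L2_set (\<lambda>k. norm (D a k)) F + L2_set (\<lambda>k. norm (\<Sum>j\<in>J. D j k)) F"
          by (rule L2_set_triangle_ineq)
        finally show ?case
          using insert by simp
      qed (simp add: L2_set_def)
      also have "\<dots> \<le> (\<Sum>j\<in>J. c j)"
        by (intro sum_mono order_trans[OF L2_set_le_ell2_norm[OF D(1) F] D(2)])
      also have "\<dots> \<le> (\<Sum>\<^sub>\<infinity>j. c j)"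
        using c J c_nonneg by (intro finite_sum_le_infsum) auto
      finally show ?thesis .
    qed
    then show "\<forall>\<^sub>F J in finite_subsets_at_top UNIV.
        L2_set (\<lambda>k. norm (\<Sum>j\<in>J. D j k)) F \<le> (\<Sum>\<^sub>\<infinity>j. c j)"
      by (auto intro: eventually_finite_subsets_at_top_weakI)
  qed simp
  then show "is_ell2 s" "ell2_norm s \<le> (\<Sum>\<^sub>\<infinity>j. c j)"
    using ell2_boundedI by blast+
qed

text \<open>
  If the inequality failed at every \<open>k\<close> with \<open>f k \<noteq> 0\<close>, it would be reversed at every \<open>k\<close> and
  strictly so at one of them, and summing the squares would contradict the assumption.
\<close>

lemma ex_norm_le_if_ell2_norm_le:
  fixes f :: "'k \<Rightarrow> 'a::real_normed_vector" and g :: "'k \<Rightarrow> 'b::real_normed_vector"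
  assumes f: "is_ell2 f" and g: "is_ell2 g"
    and le: "ell2_norm g \<le> c * ell2_norm f" and pos: "0 < ell2_norm f"
  shows "\<exists>k. f k \<noteq> 0 \<and> norm (g k) \<le> c * norm (f k)"
proof (rule ccontr)
  assume "\<not> ?thesis"
  then have gt: "c * norm (f k) < norm (g k)" if "f k \<noteq> 0" for k
    using that by (auto simp: not_le)
  have c: "0 \<le> c"
    using order_trans[OF ell2_norm_nonneg le] pos by (simp add: zero_le_mult_iff)
  obtain k0 where k0: "f k0 \<noteq> 0"
    using pos by (force simp: ell2_norm_def)
  have "(c * ell2_norm f)\<^sup>2 < (ell2_norm g)\<^sup>2"
  proof (rule has_sum_strict_mono)
    show "((\<lambda>k. (c * norm (f k))\<^sup>2) has_sum (c * ell2_norm f)\<^sup>2) UNIV"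
      unfolding power_mult_distrib by (intro has_sum_cmult_right has_sum_ell2_norm f)
    show "((\<lambda>k. (norm (g k))\<^sup>2) has_sum (ell2_norm g)\<^sup>2) UNIV"
      by (rule has_sum_ell2_norm[OF g])
    show "(c * norm (f k))\<^sup>2 \<le> (norm (g k))\<^sup>2" for k
      using gt[of k] c by (cases "f k = 0") (auto intro!: power_mono)
    show "(c * norm (f k0))\<^sup>2 < (norm (g k0))\<^sup>2"
      using gt[OF k0] c by (intro power_strict_mono) auto
  qed simp
  with le show False
    using power_mono[OF le ell2_norm_nonneg, of 2] by simp
qed


section \<open>Localization\<close>

text \<open>
  The square of the norm of \<open>localize v y k\<close> is the sum over \<open>i\<close> of
  \<open>(cmod (v (i - k)))\<^sup>2 * (norm (y i))\<^sup>2\<close>; the additional sum over \<open>k\<close>, taken first, replaces the first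
  factor by \<open>(norm v)\<^sup>2\<close>. All terms are nonnegative, so the sums may be exchanged.
\<close>

lemma has_sum_localize:
  fixes v :: "('g::ab_group_add, complex) ell2" and y :: "('g, 'y::complex_inner_space) ell2"
  shows "((\<lambda>k. (norm (localize v y k))\<^sup>2) has_sum (norm v * norm y)\<^sup>2) UNIV"
proof -
  let ?h = "\<lambda>(i, k). (cmod (ell2_apply v (i - k)))\<^sup>2 * (norm (ell2_apply y i))\<^sup>2"
  have sq: "((\<lambda>i. (norm (ell2_apply u i))\<^sup>2) has_sum (norm u)\<^sup>2) UNIV"
    for u :: "('g, 'z::real_normed_vector) ell2"
    using has_sum_ell2_norm[of "ell2_apply u"] ell2_apply[of u] by (simp add: norm_ell2.rep_eq)
  have inner: "((\<lambda>k. ?h (i, k)) has_sum (norm v)\<^sup>2 * (norm (ell2_apply y i))\<^sup>2) UNIV" for i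
  proof -
    have bij: "bij_betw (\<lambda>k. i - k) UNIV UNIV"
      by (rule bij_betw_byWitness[where f' = "\<lambda>k. i - k"]) auto
    show ?thesis
      using has_sum_reindex_bij_betw[OF bij, of "\<lambda>m. (cmod (ell2_apply v m))\<^sup>2"] sq[of v]
      by (auto intro!: has_sum_cmult_left)
  qed
  have outer: "((\<lambda>i. (norm v)\<^sup>2 * (norm (ell2_apply y i))\<^sup>2) has_sum (norm v)\<^sup>2 * (norm y)\<^sup>2) UNIV"
    by (intro has_sum_cmult_right sq)
  have "?h summable_on UNIV \<times> UNIV"
    by (rule summable_on_SigmaI[OF inner]) (use outer in \<open>auto simp: summable_on_def\<close>)
  then have "(?h has_sum (norm v)\<^sup>2 * (norm y)\<^sup>2) (UNIV \<times> UNIV)"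
    by (rule has_sum_SigmaI[OF inner outer])
  then have "((\<lambda>(k, i). ?h (i, k)) has_sum (norm v * norm y)\<^sup>2) (UNIV \<times> UNIV)"
    by (subst (asm) has_sum_swap) (simp add: power_mult_distrib)
  then show ?thesis
  proof (rule has_sum_SigmaD)
    show "((\<lambda>i. case (k, i) of (k, i) \<Rightarrow> ?h (i, k)) has_sum (norm (localize v y k))\<^sup>2) UNIV" for k
      using sq[of "localize v y k"] by (simp add: localize_apply norm_scaleC power_mult_distrib)
  qed
qed

lemma ell2_localize:
  fixes v :: "('g::ab_group_add, complex) ell2" and y :: "('g, 'y::complex_inner_space) ell2"
  shows "is_ell2 (localize v y)" "ell2_norm (localize v y) = norm v * norm y"
  using has_sum_localize[of v y] unfolding is_ell2_def ell2_norm_def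
  by (auto simp: summable_on_def infsumI)

lemma proj_op_apply_diff:
  fixes x :: "('g::ab_group_add, 'y::complex_inner_space) ell2"
  shows "ell2_apply (proj_op W k x) i = (if i - k \<in> W then ell2_apply x i else 0)"
proof -
  have "i \<in> (+) k ` W \<longleftrightarrow> i - k \<in> W"
    by (metis add_diff_cancel_left' diff_add_cancel add.commute image_iff)
  then show ?thesis
    by (simp add: proj_op_apply)
qed

text \<open>
  At a point \<open>i\<close> of \<open>k + W\<close> the section contributes \<open>b i (w (i - j - k) *\<^sub>C x (i - j))\<close>, where complex
  linearity of \<open>b i\<close> extracts the scalar \<open>w (i - k - j)\<close>, which is the value of \<open>V\<^sub>j w\<close> at \<open>i - k\<close>;
  outside \<open>k + W\<close> it contributes \<open>0\<close>, which is the effect of \<open>P\<^sub>0\<close> on the window. The inner projection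
  acts trivially because \<open>w\<close> vanishes outside \<open>W\<close>.
\<close>

lemma section_op_localize_diff:
  fixes b :: "'g::ab_group_add \<Rightarrow> 'y::complex_inner_space \<Rightarrow>\<^sub>L 'y" and j :: 'g
  assumes b: "b \<in> ell_infty" and w: "ell2_supp w \<subseteq> W"
  defines "T \<equiv> mult_op b o\<^sub>L shift_op j"
  shows "section_op W T k (localize w x k) - localize w (T x) k
    = localize (proj_op W 0 (shift_op j w) - w) (T x) k"
proof -
  have bdd: "bounded (range b)" and lin: "blinfun_apply (b i) (c *\<^sub>C y) = c *\<^sub>C b i y" for i c y
    using b by (auto simp: ell_infty_def clinear_blinfun_def)
  have diff: "(c - d) *\<^sub>C y = c *\<^sub>C y - d *\<^sub>C y" for c d and y :: 'y
    using scaleC_add_left[of "c - d" d y] by (simp add: algebra_simps)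
  have zero: "0 *\<^sub>C y = 0" for y :: 'y
    using diff[of 0 0 y] by simp
  have proj: "proj_op W k (localize w x k) = localize w x k"
    using w by (force simp: ell2_apply_inject[symmetric] proj_op_apply_diff localize_apply
        ell2_supp_def zero)
  show ?thesis
    unfolding section_op_def T_def
    by (auto simp: ell2_apply_inject[symmetric] minus_ell2.rep_eq proj proj_op_apply_diff
        localize_apply mult_op_apply[OF bdd] shift_op_apply lin diff zero diff_diff_eq add.commute
        intro!: ext)
qed

lemma norm_mult_op_shift_op_le:
  assumes "b \<in> ell_infty"
  shows "norm ((mult_op b o\<^sub>L shift_op j) x) \<le> sup_norm b * norm x"
proof -
  have "bdd_above (range (\<lambda>i. norm (b i)))"
    using assms by (auto simp: ell_infty_def bounded_iff bdd_above_def)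
  then have "norm (b i) \<le> sup_norm b" for i
    unfolding sup_norm_def by (rule cSUP_upper2) auto
  then have "norm (mult_op b (shift_op j x)) \<le> sup_norm b * norm (shift_op j x)"
    unfolding mult_op.rep_eq by (rule mult_fun_bound)
  moreover have "norm (shift_op j x) = norm x"
    using ell2_apply[of x]
    by (simp add: shift_op.rep_eq norm_ell2.rep_eq shift_fun.rep_eq ell2_shift(2))
  ultimately show ?thesis
    by simp
qed


section \<open>Sections of operators in the Wiener algebra\<close>

text \<open>
  For fixed \<open>k\<close> the difference depends linearly and continuously on \<open>A\<close>, so that the representation of
  \<open>A\<close> may be inserted termwise.
\<close>

lemma section_op_localize_close:
  fixes A :: "('g::ab_group_add, 'y::complex_inner_space) ell2 \<Rightarrow>\<^sub>L ('g, 'y) ell2"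
    and x :: "('g, 'y) ell2"
  assumes A: "wiener_representation A b" and w: "ell2_supp w \<subseteq> W"
  defines "s \<equiv> \<lambda>k. section_op W A k (localize w x k) - localize w (A x) k"
  shows "is_ell2 s" "ell2_norm s \<le> loc_error W w b * (norm w * norm x)"
proof -
  define T where "T j = mult_op (b j) o\<^sub>L shift_op j" for j
  define d where "d j = proj_op W 0 (shift_op j w) - w" for j
  define c where "c j = sup_norm (b j) * (norm (d j) / norm w) * (norm w * norm x)" for j
  have b: "b j \<in> ell_infty" for j
    using A by (simp add: wiener_representation_def)
  have sum: "((\<lambda>j. localize (d j) (T j x) k) has_sum s k) UNIV" for k
  proof -
    have lin: "bounded_linear (\<lambda>B. section_op W B k (localize w x k) - localize w (B x) k)"
      unfolding section_op_def localize_def blinfun_apply_blinfun_compose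
      by (intro bounded_linear_intros)
    have "(T has_sum A) UNIV"
      using A by (simp add: wiener_representation_def T_def[abs_def])
    from has_sum_bounded_linear[OF lin this] show ?thesis
      unfolding T_def d_def s_def section_op_localize_diff[OF b w] .
  qed
  have bound: "ell2_norm (localize (d j) (T j x)) \<le> c j" for j
  proof (cases "w = 0")
    case True
    \<comment> \<open>The quotient by \<open>norm w\<close> in \<open>c j\<close> is then \<open>0\<close>, and so is the window \<open>d j\<close>.\<close>
    then show ?thesis
      by (simp add: d_def c_def ell2_localize blinfun.zero_right)
  next
    case False
    have "norm (d j) * norm (T j x) \<le> norm (d j) * (sup_norm (b j) * norm x)"
      unfolding T_def by (intro mult_left_mono norm_mult_op_shift_op_le b) simp
    also have "\<dots> = c j"
      using False by (simp add: c_def)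
    finally show ?thesis
      by (simp add: ell2_localize)
  qed
  have summable: "c summable_on UNIV"
    unfolding c_def d_def by (intro summable_on_cmult_left summable_loc_error[OF A])
  have total: "(\<Sum>\<^sub>\<infinity>j. c j) = loc_error W w b * (norm w * norm x)"
    unfolding c_def d_def loc_error_def by (rule infsum_cmult_left')
  show "is_ell2 s" "ell2_norm s \<le> loc_error W w b * (norm w * norm x)"
    using ell2_has_sum_le[OF sum ell2_localize(1) bound summable] total by auto
qed

theorem proposition5p13:
  fixes A :: "('g::{ab_group_add,countable}, 'y::complex_hilbert_space) ell2 \<Rightarrow>\<^sub>L ('g, 'y) ell2"
    and b :: "'g \<Rightarrow> 'g \<Rightarrow> 'y \<Rightarrow>\<^sub>L 'y"
    and W :: "'g set"
    and w :: "('g, complex) ell2"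
    and x :: "('g, 'y) ell2"
  assumes "wiener_representation A b"
    and "finite W"
    and "w \<noteq> 0"
    and "ell2_supp w \<subseteq> W"
    and "x \<noteq> 0"
  shows "\<exists>k. localize w x k \<noteq> 0 \<and>
    norm (blinfun_apply (section_op W A k) (localize w x k)) / norm (localize w x k)
      \<le> norm (blinfun_apply A x) / norm x + loc_error W w b"
proof -
  let ?c = "norm (A x) / norm x + loc_error W w b"
  let ?s = "\<lambda>k. section_op W A k (localize w x k)"
  let ?d = "\<lambda>k. ?s k - localize w (A x) k"
  note d = section_op_localize_close[OF assms(1,4), of x]
  have s: "is_ell2 ?s" "ell2_norm ?s \<le> ell2_norm ?d + ell2_norm (localize w (A x))"
    using ell2_add[OF d(1) ell2_localize(1), of w "A x"] by simp_all
  have "ell2_norm ?s \<le> loc_error W w b * (norm w * norm x) + norm w * norm (A x)"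
    using s(2) d(2) by (simp add: ell2_localize)
  also have "\<dots> = ?c * ell2_norm (localize w x)"
    using assms(5) by (simp add: ell2_localize field_simps)
  finally have "\<exists>k. localize w x k \<noteq> 0 \<and> norm (?s k) \<le> ?c * norm (localize w x k)"
    using assms(3,5)
    by (intro ex_norm_le_if_ell2_norm_le[OF ell2_localize(1) s(1)]) (auto simp: ell2_localize)
  then show ?thesis
    by (auto simp: pos_divide_le_eq)
qed

end
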